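(* As formal power series in $q$, \[ \sum_{n\geq 1} \frac{(-1)^n q^{2n}}{1-q^{2n}}\,\frac{(-q;q^2)_{n-1}}{(q^2;q^2)_{n-1}}\,q^{n-1} \;=\; \psi(-q) - \frac{1}{1+q}, \] where $\psi(q)=\sum_{n\geq 0} q^{n(n+1)/2}$.
   Context: For a non-negative integer $L$, $(a;q)_L=\prod_{i=0}^{L-1}(1-aq^i)$ (so $(a;q)_0=1$). *)

theory Defs
  imports "HOL-Computational_Algebra.Formal_Power_Series" "HOL-Analysis.Infinite_Sum"
begin

definition qpoch :: "'a::comm_ring_1 \<Rightarrow> 'a \<Rightarrow> nat \<Rightarrow> 'a" where
  "qpoch a q L = (\<Prod>i<L. 1 - a * q ^ i)"

text \<open>
  The infinite sum is taken in the topology of formal power series given by the library metric: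
  the \<open>X\<close>-adic one. It converges for every argument with constant term \<open>0\<close>.
\<close>
definition psi :: "'a::comm_ring_1 fps \<Rightarrow> 'a fps" where
  "psi q = (\<Sum>\<^sub>\<infinity>n::nat. q ^ (n * (n + 1) div 2))"

end

theory Submission
  imports Defs
begin

text \<open>
  Put \<open>x = - q\<close>. Up to the factor \<open>1 - x\<close> and the missing term for \<open>n = 0\<close>, the left-hand side is the
  \<open>q\<close>-binomial series with base \<open>x\<^sup>2\<close>, numerator parameter \<open>1 / x\<close> and argument \<open>x\<^sup>3\<close>. Its
  functional equation under \<open>z \<mapsto> x\<^sup>2 z\<close>, applied repeatedly, turns it into the product of
  \<open>(1 - x\<^sup>2\<^sup>k) / (1 - x\<^sup>2\<^sup>k\<^sup>-\<^sup>1)\<close> over \<open>k \<ge> 1\<close>, which is \<open>\<psi>(x)\<close> by Gauss's identity. Gauss's identity is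
  obtained from its finite form due to Shanks. Infinite products are avoided by working with
  finite sums and products modulo powers of \<open>x\<close>.
\<close>

unbundle fps_syntax

text \<open>Convergence in the X-adic topology is tested coefficientwise: coefficient k of a finite
  partial sum is constant once the index set contains \<open>{..k}\<close>.\<close>

lemma has_sum_fpsI:
  fixes f :: "nat \<Rightarrow> 'a::ab_group_add fps"
  assumes zero: "\<And>n k. k < n \<Longrightarrow> f n $ k = 0"
    and coeff: "\<And>k. S $ k = (\<Sum>n\<le>k. f n $ k)"
  shows "(f has_sum S) UNIV"
  unfolding has_sum_def
proof (rule tendsto_fpsI)
  fix k
  have "sum f F $ k = S $ k" if "finite F" "{..k} \<subseteq> F" for F
    unfolding coeff fps_sum_nth using that zero
    by (intro sum.mono_neutral_right) (auto simp: not_le)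
  then show "\<forall>\<^sub>F F in finite_subsets_at_top UNIV. sum f F $ k = S $ k"
    by (subst eventually_finite_subsets_at_top) (intro exI[of _ "{..k}"], auto)
qed

text \<open>Shanks's finite form of Gauss's identity. The function \<open>i\<close> supplies the
  inverses of the odd factors, so the argument is polynomial algebra in any commutative
  ring.\<close>

lemma sum_triangular_powers:
  fixes x :: "'a::comm_ring_1"
  assumes inv: "\<And>k. (1 - x ^ (2 * k + 1)) * i k = 1"
  defines "r \<equiv> \<lambda>k. (1 - x ^ (2 * k + 2)) * i k"
  shows "(\<Sum>s<2 * n. x ^ (s * (s + 1) div 2))
       = (\<Sum>s<n. (\<Prod>k=s..<n. r k) * x ^ (s * (2 * n + 1)))"
proof (induction n)
  case (Suc n)
  define A where "A = (\<lambda>n s. (\<Prod>k=s..<n. r k) * x ^ (s * (2 * n + 1)))"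
  have r: "r k * (1 - x ^ (2 * k + 1)) = 1 - x ^ (2 * k + 2)" for k
    unfolding r_def mult.assoc mult.commute[of "i k"] inv by simp
  have A_Suc: "A (Suc n) s = x ^ (2 * s) * r n * A n s" if "s \<le> n" for s
    using that by (simp add: A_def algebra_simps flip: power_add)
  have shift: "A n m * x ^ (2 * n + 1) = r m * A n (Suc m)" if "m < n" for m
    using that by (simp add: A_def prod.atLeast_Suc_lessThan algebra_simps flip: power_add)
  have diff: "A (Suc n) s - A n s
      = i n * (x ^ (2 * s) * (1 - x ^ (2 * n + 2)) - (1 - x ^ (2 * n + 1))) * A n s"
    if "s \<le> n" for s
  proof -
    have "A (Suc n) s - A n s = x ^ (2 * s) * r n * A n s - (1 - x ^ (2 * n + 1)) * i n * A n s"
      unfolding A_Suc[OF that] inv by simp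
    then show ?thesis
      by (simp add: r_def algebra_simps)
  qed
  \<comment> \<open>The right-hand sides for \<open>n + 1\<close> and \<open>n\<close> differ termwise by a telescoping sequence.\<close>
  have tel: "(\<Sum>s<Suc m. A (Suc n) s - A n s)
      = x ^ (2 * n + 1) * i n * A n m * (1 - x ^ (2 * m + 1))" if "m \<le> n" for m
    using that
  proof (induction m)
    case 0
    show ?case
      using diff[of 0] by (simp add: algebra_simps)
  next
    case (Suc m)
    have "(\<Sum>s<Suc m. A (Suc n) s - A n s)
        = i n * (1 - x ^ (2 * m + 1)) * (A n m * x ^ (2 * n + 1))"
      using Suc by (simp only: mult_ac Suc_leD)
    also have "\<dots> = i n * (r m * (1 - x ^ (2 * m + 1))) * A n (Suc m)"
      using shift[of m] Suc.prems by (simp only: mult_ac Suc_le_eq)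
    also have "\<dots> = i n * (1 - x ^ (2 * m + 2)) * A n (Suc m)"
      unfolding r ..
    finally show ?case
      unfolding sum.lessThan_Suc[of _ "Suc m"] diff[OF Suc.prems]
      by (simp add: algebra_simps power_add del: sum.lessThan_Suc)
  qed
  \<comment> \<open>The step to \<open>Suc n\<close> adds the triangular powers for s = 2n and s =
    2n + 1. On the right they arise as \<open>A n n\<close> and as the telescoped total
    \<open>x ^ (2 * n + 1) * A n n\<close>.\<close>
  have "2 * n * (2 * n + 1) div 2 = n * (2 * n + 1)"
    "(2 * n + 1) * (2 * n + 1 + 1) div 2 = (2 * n + 1) + n * (2 * n + 1)" "2 * Suc n = 2 * n + 1 + 1"
    by (simp_all add: algebra_simps)
  then have lhs: "(\<Sum>s<2 * Suc n. x ^ (s * (s + 1) div 2))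
      = (\<Sum>s<2 * n. x ^ (s * (s + 1) div 2)) + x ^ (n * (2 * n + 1))
        + x ^ (2 * n + 1) * x ^ (n * (2 * n + 1))"
    by (simp only: sum.lessThan_Suc power_add flip: Suc_eq_plus1)
  have "(\<Sum>s<Suc n. A (Suc n) s) = (\<Sum>s<Suc n. A (Suc n) s - A n s) + (\<Sum>s<Suc n. A n s)"
    by (simp add: sum_subtractf)
  also have "(\<Sum>s<Suc n. A (Suc n) s - A n s) = x ^ (2 * n + 1) * A n n"
  proof -
    have "(\<Sum>s<Suc n. A (Suc n) s - A n s)
        = x ^ (2 * n + 1) * A n n * ((1 - x ^ (2 * n + 1)) * i n)"
      unfolding tel[OF order_refl] by (simp only: mult_ac)
    then show ?thesis
      unfolding inv by simp
  qed
  also have "(\<Sum>s<Suc n. A n s) = (\<Sum>s<2 * n. x ^ (s * (s + 1) div 2)) + A n n"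
    unfolding Suc.IH by (simp add: A_def)
  also have "A n n = x ^ (n * (2 * n + 1))"
    by (simp add: A_def)
  finally have "(\<Sum>s<2 * Suc n. x ^ (s * (s + 1) div 2)) = (\<Sum>s<Suc n. A (Suc n) s)"
    unfolding lhs by (simp only: add_ac)
  then show ?case
    unfolding A_def .
qed simp

text \<open>In Shanks's sum the product is the summand s = 0; all others carry a factor
  \<open>x ^ (2 * n + 1)\<close>.\<close>

lemma dvd_product_minus_triangular_sum:
  fixes x :: "'a::comm_ring_1"
  assumes inv: "\<And>k. (1 - x ^ (2 * k + 1)) * i k = 1"
  shows "x ^ n dvd (\<Prod>k<n. (1 - x ^ (2 * k + 2)) * i k) - (\<Sum>s<2 * n. x ^ (s * (s + 1) div 2))"
proof (cases n)
  case (Suc m)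
  define r where "r = (\<lambda>k. (1 - x ^ (2 * k + 2)) * i k)"
  have "(\<Prod>k<n. r k) - (\<Sum>s<2 * n. x ^ (s * (s + 1) div 2))
      = - (\<Sum>s<m. (\<Prod>k=Suc s..<n. r k) * x ^ (Suc s * (2 * n + 1)))"
    unfolding sum_triangular_powers[OF inv, folded r_def] unfolding Suc sum.lessThan_Suc_shift
    by (simp add: atLeast0LessThan)
  moreover have "x ^ n dvd \<dots>"
    unfolding dvd_minus_iff by (intro dvd_sum dvd_mult le_imp_power_dvd) simp
  ultimately show ?thesis
    by (simp add: r_def)
qed simp

text \<open>
  \<open>G m\<close> is the \<open>N\<close>-th partial sum of the \<open>q\<close>-binomial series at \<open>z = x\<^bsup>2m+1\<^esup>\<close>. Its coefficients contain
  \<open>(1/x; x\<^sup>2)\<^sub>n = - (1 - x) (x; x\<^sup>2)\<^sub>n\<^sub>-\<^sub>1 / x\<close>, and the division by \<open>x\<close> is absorbed into the power of \<open>z\<close>.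
\<close>
lemma q_binomial_partial_sum:
  fixes x :: "'a::comm_ring_1"
  assumes u_0: "(1 - x ^ 2) * u 0 = 1"
    and u_Suc: "\<And>j. (1 - x ^ (2 * j + 4)) * u (Suc j) = (1 - x ^ (2 * j + 1)) * u j"
  defines "G \<equiv> \<lambda>m N. 1 - (1 - x) * (\<Sum>j<N. x ^ (2 * m + (2 * m + 1) * j) * u j)"
  shows "(1 - x ^ (2 * m + 1)) * G m N - (1 - x ^ (2 * m)) * G (Suc m) N
       = (1 - x) * x ^ (2 * m + (2 * m + 1) * N) * (1 - x ^ (2 * N + 2)) * u N"
proof (induction N)
  case 0
  have "(1 - x) * x ^ (2 * m) * ((1 - x ^ 2) * u 0) = x ^ (2 * m) - x ^ (2 * m + 1)"
    unfolding u_0 by (simp add: algebra_simps)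
  then show ?case
    by (simp add: G_def mult.assoc power2_eq_square)
next
  case (Suc N)
  define p where "p = x ^ (2 * m + (2 * m + 1) * N)"
  have G_Suc: "G m (Suc N) = G m N - (1 - x) * p * u N"
    "G (Suc m) (Suc N) = G (Suc m) N - (1 - x) * x ^ (2 * N + 2) * p * u N"
    by (simp_all add: G_def p_def algebra_simps power_add)
  have "(1 - x) * x ^ (2 * m + (2 * m + 1) * Suc N) * (1 - x ^ (2 * Suc N + 2)) * u (Suc N)
      = (1 - x) * x ^ (2 * m + 1) * p * ((1 - x ^ (2 * N + 4)) * u (Suc N))"
  proof -
    have "2 * Suc N + 2 = 2 * N + 4" "x ^ (2 * m + (2 * m + 1) * Suc N) = x ^ (2 * m + 1) * p"
      by (simp_all add: p_def algebra_simps flip: power_add)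
    then show ?thesis
      by (simp only: mult.assoc)
  qed
  also have "\<dots> = (1 - x) * x ^ (2 * m + 1) * p * (1 - x ^ (2 * N + 1)) * u N"
    by (simp add: u_Suc mult.assoc)
  also have "\<dots> = (1 - x) * p * (1 - x ^ (2 * N + 2)) * u N
      - (1 - x ^ (2 * m + 1)) * ((1 - x) * p * u N)
      + (1 - x ^ (2 * m)) * ((1 - x) * x ^ (2 * N + 2) * p * u N)"
    by (simp add: algebra_simps power_add)
  also have "\<dots> = (1 - x ^ (2 * m + 1)) * G m (Suc N) - (1 - x ^ (2 * m)) * G (Suc m) (Suc N)"
    unfolding G_Suc Suc.IH[folded p_def, symmetric] by (simp only: right_diff_distrib) simp
  finally show ?case by (rule sym)
qed

lemma dvd_q_binomial_minus_product:
  fixes x :: "'a::comm_ring_1"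
  assumes inv: "\<And>k. (1 - x ^ (2 * k + 1)) * i k = 1"
    and u_0: "(1 - x ^ 2) * u 0 = 1"
    and u_Suc: "\<And>j. (1 - x ^ (2 * j + 4)) * u (Suc j) = (1 - x ^ (2 * j + 1)) * u j"
  shows "x ^ N dvd i 0 - (\<Sum>j<N. x ^ (3 * j + 2) * u j) - (\<Prod>k<N. (1 - x ^ (2 * k + 2)) * i k)"
proof -
  define G where "G = (\<lambda>m. 1 - (1 - x) * (\<Sum>j<N. x ^ (2 * m + (2 * m + 1) * j) * u j))"
  define P where "P = (\<lambda>m. \<Prod>k<m. (1 - x ^ (2 * k + 2)) * i k)"
  \<comment> \<open>The factor \<open>i 0\<close> supplies the denominator 1 - x, so that iterating
    from \<open>G 1\<close> builds up Gauss's product from its first factor.\<close>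
  have "x ^ N dvd i 0 * G 1 - P m * i m * G (Suc m)" for m
  proof (induction m)
    case 0
    show ?case by (simp add: P_def)
  next
    case (Suc m)
    let ?M = "Suc m"
    \<comment> \<open>\<open>E\<close> is the truncation error in the functional equation.\<close>
    define E where "E = (1 - x ^ (2 * ?M + 1)) * G ?M - (1 - x ^ (2 * ?M)) * G (Suc ?M)"
    have "x ^ N dvd E"
      unfolding E_def G_def q_binomial_partial_sum[of x u, OF u_0 u_Suc]
      by (intro dvd_mult2 dvd_mult le_imp_power_dvd) simp
    moreover have "P m * i m * G ?M = P m * i m * ((1 - x ^ (2 * ?M + 1)) * i ?M) * G ?M"
      unfolding inv by simp
    then have "P m * i m * G ?M - P ?M * i ?M * G (Suc ?M) = P m * i m * i ?M * E"
      by (simp only: E_def P_def) (simp add: algebra_simps)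
    ultimately have "x ^ N dvd P m * i m * G ?M - P ?M * i ?M * G (Suc ?M)"
      by simp
    from dvd_add[OF Suc.IH this] show ?case
      by simp
  qed
  \<comment> \<open>After N steps both \<open>i N\<close> and \<open>G (Suc N)\<close> are 1 modulo
    \<open>x ^ N\<close>, which leaves only the product.\<close>
  note main = this[of N]
  have "x ^ N dvd 1 - G (Suc N)"
    unfolding G_def diff_diff_eq2 add_diff_cancel_left'
    by (rule dvd_mult, rule dvd_sum, rule dvd_mult2, rule le_imp_power_dvd) simp
  moreover have "1 - i N = (1 - x ^ (2 * N + 1)) * i N - i N"
    unfolding inv ..
  then have "1 - i N = - (x ^ (2 * N + 1) * i N)"
    by (simp add: left_diff_distrib)
  then have "x ^ N dvd 1 - i N"
    by (simp only: dvd_minus_iff) (rule dvd_mult2, rule le_imp_power_dvd, simp)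
  moreover have "P N * i N * G (Suc N) - P N = - P N * (1 - i N) - P N * i N * (1 - G (Suc N))"
    by (simp add: algebra_simps)
  ultimately have "x ^ N dvd P N * i N * G (Suc N) - P N"
    by (metis dvd_diff dvd_mult)
  from dvd_add[OF main this] have "x ^ N dvd i 0 * G 1 - P N"
    by simp
  moreover have "i 0 * G 1 = i 0 - (\<Sum>j<N. x ^ (3 * j + 2) * u j)"
  proof -
    have "2 * 1 + (2 * 1 + 1) * j = 3 * j + 2" for j :: nat
      by simp
    then have G_1: "G 1 = 1 - (1 - x ^ (2 * 0 + 1)) * (\<Sum>j<N. x ^ (3 * j + 2) * u j)"
      unfolding G_def by simp
    have "i 0 * G 1
        = i 0 - ((1 - x ^ (2 * 0 + 1)) * i 0) * (\<Sum>j<N. x ^ (3 * j + 2) * u j)"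
      unfolding G_1 by (simp add: algebra_simps)
    then show ?thesis
      unfolding inv by simp
  qed
  ultimately show ?thesis
    by (simp add: P_def)
qed

lemma fps_nth_eq_0_if_uminus_X_power_dvd:
  fixes f :: "'a::comm_ring_1 fps"
  assumes "(- fps_X) ^ n dvd f" "k < n"
  shows "f $ k = 0"
proof -
  from assms(1) obtain g where "f = (- fps_X) ^ n * g" ..
  then have "f = fps_X ^ n * ((-1) ^ n * g)"
    by (simp add: power_minus[of fps_X] mult_ac)
  then show ?thesis
    using assms(2) by (simp add: fps_X_power_mult_nth)
qed

lemma le_triangular: "n \<le> n * (n + 1) div (2::nat)"
  by (cases n) auto

lemma uminus_X_power_triangular_nth:
  "k < n \<Longrightarrow> (- fps_X :: 'a::comm_ring_1 fps) ^ (n * (n + 1) div 2) $ k = 0"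
  by (rule fps_nth_eq_0_if_uminus_X_power_dvd[OF le_imp_power_dvd[OF le_triangular]])

lemma psi_uminus_X_nth:
  "psi (- fps_X :: 'a::comm_ring_1 fps) $ k = (\<Sum>n\<le>k. ((- fps_X) ^ (n * (n + 1) div 2)) $ k)"
proof -
  let ?f = "\<lambda>n. (- fps_X :: 'a fps) ^ (n * (n + 1) div 2)"
  have "(?f has_sum Abs_fps (\<lambda>k. \<Sum>n\<le>k. ?f n $ k)) UNIV"
    using uminus_X_power_triangular_nth by (rule has_sum_fpsI) simp_all
  then show ?thesis
    unfolding psi_def by (simp add: infsumI)
qed

theorem theorem5p1:
  fixes q :: "'a::field_char_0 fps"
  assumes "q = fps_X"
  shows "((\<lambda>n::nat. (-1) ^ n * q ^ (2 * n) / (1 - q ^ (2 * n))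
            * (qpoch (- q) (q ^ 2) (n - 1) / qpoch (q ^ 2) (q ^ 2) (n - 1))
            * q ^ (n - 1))
          has_sum (psi (- q) - 1 / (1 + q))) {1..}"
    (is "(?f has_sum ?S) _")
proof -
  define x where "x = - q"
  define i where "i = (\<lambda>k. inverse (1 - x ^ (2 * k + 1)))"
  \<comment> \<open>With j = n - 1, the denominator 1 - q^(2n) of the summand extends the
    q-factorial from j to j + 1 factors.\<close>
  define u where "u = (\<lambda>j. qpoch x (x ^ 2) j * inverse (qpoch (x ^ 2) (x ^ 2) (j + 1)))"
  have x_nth_0: "x $ 0 = 0"
    by (simp add: x_def assms)
  then have x2_nth_0: "x ^ 2 $ 0 = 0"
    by (simp add: power2_eq_square)
  have unit: "(1 - x ^ Suc k) $ 0 \<noteq> 0" for k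
    by (simp add: x_nth_0)
  have qpoch_unit: "qpoch (x ^ 2) (x ^ 2) k $ 0 \<noteq> 0" for k
    by (induction k) (simp_all add: qpoch_def x2_nth_0)
  have inv: "(1 - x ^ (2 * k + 1)) * i k = 1" for k
    using unit[of "2 * k"] by (simp add: i_def inverse_mult_eq_1')
  have u_0: "(1 - x ^ 2) * u 0 = 1"
    using unit[of 1] by (simp add: u_def qpoch_def inverse_mult_eq_1' numeral_2_eq_2)
  have u_Suc: "(1 - x ^ (2 * j + 4)) * u (Suc j) = (1 - x ^ (2 * j + 1)) * u j" for j
  proof -
    have "2 * j + 4 = 2 + 2 * Suc j"
      by simp
    then have e: "x ^ (2 * j + 4) = x ^ 2 * (x ^ 2) ^ Suc j" "x ^ (2 * j + 1) = x * (x ^ 2) ^ j"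
      by (simp_all only: power_add power_mult power_one_right mult.commute[of x])
    have "(1 - x ^ (2 * j + 4)) * inverse (1 - x ^ (2 * j + 4)) = 1"
      using unit[of "2 * j + 3"] by (intro inverse_mult_eq_1') (simp add: eval_nat_numeral)
    then show ?thesis
      unfolding u_def qpoch_def e by (simp add: fps_inverse_mult)
  qed
  have f_Suc: "?f (Suc j) = - (x ^ (3 * j + 2) * u j)" for j
  proof -
    \<comment> \<open>The signs agree because 3j + 2 and j have the same parity.\<close>
    have "x ^ (3 * j + 2) = (-1) ^ j * q ^ (2 * Suc j + j)"
      by (cases "even j") (simp_all add: x_def uminus_power_if)
    then have num: "(-1) ^ Suc j * q ^ (2 * Suc j) * q ^ j = - (x ^ (3 * j + 2))"
      by (simp only: power_add power_Suc mult.assoc mult_minus_left mult_1_left)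
    have sq: "q ^ 2 = x ^ 2"
      by (simp add: x_def)
    have den: "1 - q ^ (2 * Suc j) = 1 - x ^ 2 * (x ^ 2) ^ j"
      unfolding power_mult sq by simp
    have "(1 - x ^ 2 * (x ^ 2) ^ j) $ 0 \<noteq> 0"
      by (simp add: x2_nth_0)
    then have "?f (Suc j) = ((-1) ^ Suc j * q ^ (2 * Suc j) * q ^ j)
        * (qpoch x (x ^ 2) j
          * (inverse (qpoch (x ^ 2) (x ^ 2) j) * inverse (1 - x ^ 2 * (x ^ 2) ^ j)))"
      unfolding den sq x_def[symmetric] diff_Suc_1
      by (simp only: fps_divide_unit qpoch_unit mult_ac not_False_eq_True)
    then show ?thesis
      unfolding num by (simp add: u_def qpoch_def fps_inverse_mult)
  qed
  \<comment> \<open>The denominator vanishes at \<open>n = 0\<close>, and division by zero gives zero.\<close>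
  have f_0: "?f 0 = 0"
    by simp
  have zero: "?f n $ k = 0" if "k < n" for n k
  proof (cases n)
    case (Suc j)
    have "x ^ n dvd ?f n"
      unfolding Suc f_Suc dvd_minus_iff by (intro dvd_mult2 le_imp_power_dvd) simp
    then show ?thesis
      using that unfolding x_def assms by (rule fps_nth_eq_0_if_uminus_X_power_dvd)
  qed (use that in simp)
  have coeff: "?S $ k = (\<Sum>n\<le>k. ?f n $ k)" for k
  proof -
    let ?t = "\<lambda>s::nat. x ^ (s * (s + 1) div 2)"
    \<comment> \<open>Adding the two congruences eliminates the product. Precision
      \<open>x ^ Suc k\<close> determines coefficient k, to which the surplus terms of both sums
      contribute 0.\<close>
    have "x ^ Suc k dvd i 0 - (\<Sum>j<Suc k. x ^ (3 * j + 2) * u j) - (\<Sum>s<2 * Suc k. ?t s)"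
      using dvd_add[OF dvd_q_binomial_minus_product[of x i u "Suc k", OF inv u_0 u_Suc]
          dvd_product_minus_triangular_sum[of x i "Suc k", OF inv]]
      by (simp only: add_diff_eq diff_add_cancel)
    then have "(i 0 - (\<Sum>j<Suc k. x ^ (3 * j + 2) * u j) - (\<Sum>s<2 * Suc k. ?t s)) $ k = 0"
      unfolding x_def assms by (rule fps_nth_eq_0_if_uminus_X_power_dvd) simp
    then have "(\<Sum>s<2 * Suc k. ?t s $ k) - i 0 $ k = (\<Sum>j<Suc k. ?f (Suc j) $ k)"
      unfolding f_Suc by (simp add: fps_sum_nth sum_negf algebra_simps del: sum.lessThan_Suc)
    also have "\<dots> = (\<Sum>n<Suc (Suc k). ?f n $ k)"
      unfolding sum.lessThan_Suc_shift[of _ "Suc k"] f_0 by simp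
    also have "\<dots> = (\<Sum>n\<le>k. ?f n $ k)"
      using zero by (intro sum.mono_neutral_right) auto
    also have "(\<Sum>s<2 * Suc k. ?t s $ k) = (\<Sum>s\<le>k. ?t s $ k)"
      unfolding x_def assms
      by (intro sum.mono_neutral_right)
        (auto simp: not_le intro!: uminus_X_power_triangular_nth[simplified])
    also have "\<dots> = psi (- q) $ k"
      unfolding x_def assms psi_uminus_X_nth ..
    also have "i 0 = 1 / (1 + q)"
      by (simp add: i_def x_def assms fps_divide_unit)
    finally show ?thesis by simp
  qed
  have "(?f has_sum ?S) UNIV"
    using zero coeff by (rule has_sum_fpsI)
  then show ?thesis
    by (rule has_sum_cong_neutral[THEN iffD1, rotated -1]) (use f_0 in \<open>auto simp: not_le\<close>)
qed

end
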